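(* For every odd positive integer $d$, Algorithm 1 (described in the context) applied to the binary representation of $d$ outputs the binary representation of $R(d)$, the next odd number after $d$ in the Collatz sequence.
   Context: Reduced Collatz map: for an odd positive integer $d$, $R(d)$ is the odd positive integer obtained from $3d+1$ by dividing out all factors of $2$; equivalently, it is the next odd number after $d$ in the sequence of iterates of $f(n)=n/2$ for $n$ even, $f(n)=(3n+1)/2$ for $n$ odd. Algorithm 1. Let $d$ be an odd positive integer whose binary representation has $L$ digits. Put two digits $0$ in front of the leading $1$, obtaining a string $b_{L+1}b_L b_{L-1}\dots b_1 b_0$ of length $L+2$, where $b_0$ is the rightmost (least significant) digit and $b_{L+1}=b_L=0$. Process this string from right to left, writing output digits $c_0,c_1,\dots,c_{L+1}$ also from right to left: - Write $c_0=0$ and set Flag $=1$. - For $i=1,2,\dots,L+1$ in this order, look at the pair of adjacent digits $b_i b_{i-1}$ (written left to right): - If Flag $=0$: for the pair $00$ write $c_i=0$; for $01$ write $c_i=1$; for $10$ write $c_i=1$; for $11$ write $c_i=0$ and set Flag $=1$. - If Flag $=1$: for the pair $00$ write $c_i=1$ and set Flag $=0$; for $01$ write $c_i=0$; for $10$ write $c_i=0$; for $11$ write $c_i=1$. (Flag keeps its value unless a change is stated.) - Stop when all digits are exhausted. The output is the string $c_{L+1}c_L\dots c_0$ with all leading and all trailing zeros removed. *)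

theory Defs
  imports "HOL-Computational_Algebra.Primes"
begin

(* Binary digits are Booleans (True = 1, False = 0), and digit strings are lists in
   written order, i.e. with the most significant digit first. *)

fun binary_rep :: "nat \<Rightarrow> bool list" where
  "binary_rep n = (if n = 0 then [] else binary_rep (n div 2) @ [odd n])"

declare binary_rep.simps [simp del]

lemma binary_rep_value: "horner_sum of_bool 2 (rev (binary_rep n)) = n"
proof (induction n rule: less_induct)
  case (less n)
  show ?case
  proof (cases "n = 0")
    case True
    then show ?thesis by (simp add: binary_rep.simps)
  next
    case False
    then have "horner_sum of_bool 2 (rev (binary_rep (n div 2))) = n div 2"
      using less by simp
    with False show ?thesis
      by (subst binary_rep.simps) (simp add: mod_2_eq_odd [symmetric])
  qed
qed

lemma binary_rep_leading: "n > 0 \<Longrightarrow> binary_rep n \<noteq> [] \<and> hd (binary_rep n)"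
proof (induction n rule: less_induct)
  case (less n)
  show ?case
  proof (cases "n = 1")
    case True
    then show ?thesis by (simp add: binary_rep.simps)
  next
    case False
    with less.prems have "n div 2 < n" "n div 2 > 0" by auto
    then have "binary_rep (n div 2) \<noteq> [] \<and> hd (binary_rep (n div 2))"
      by (rule less.IH)
    with less.prems show ?thesis
      by (subst (1 2) binary_rep.simps) simp
  qed
qed

definition reduced_collatz :: "nat \<Rightarrow> nat" where
  "reduced_collatz d = (3 * d + 1) div 2 ^ multiplicity 2 (3 * d + 1)"

definition collatz :: "nat \<Rightarrow> nat" where
  "collatz n = (if even n then n div 2 else (3 * n + 1) div 2)"

lemma reduced_collatz_next_odd:
  assumes "odd d"
  shows "reduced_collatz d = (collatz ^^ (LEAST k. k > 0 \<and> odd ((collatz ^^ k) d))) d"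
proof -
  define m where "m = multiplicity 2 (3 * d + 1)"
  have "2 ^ m dvd 3 * d + 1"
    unfolding m_def by (rule multiplicity_dvd)
  then obtain q where q: "3 * d + 1 = 2 ^ m * q" ..
  have "\<not> 2 ^ Suc m dvd 3 * d + 1"
    unfolding m_def by (subst power_dvd_iff_le_multiplicity) auto
  then have "odd q"
    using q by (auto elim!: evenE)
  have "m > 0"
    using q assms \<open>odd q\<close> by (cases m) (auto dest: arg_cong [where f = even])
  have R: "reduced_collatz d = q"
    unfolding reduced_collatz_def m_def [symmetric] by (subst q) simp
  have iter: "(collatz ^^ k) d = 2 ^ (m - k) * q" if "k > 0" "k \<le> m" for k
    using that
  proof (induction k)
    case 0
    then show ?case by simp
  next
    case (Suc k)
    obtain j where j: "m = Suc (k + j)"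
      using Suc.prems by (metis less_iff_Suc_add Suc_le_lessD)
    show ?case
    proof (cases "k = 0")
      case True
      then show ?thesis
        using q assms j by (simp add: collatz_def)
    next
      case False
      then have "(collatz ^^ k) d = 2 * (2 ^ j * q)"
        using Suc j by simp
      then have "(collatz ^^ Suc k) d = collatz (2 * (2 ^ j * q))"
        by simp
      also have "\<dots> = 2 ^ j * q"
        by (simp add: collatz_def)
      finally show ?thesis
        using j by simp
    qed
  qed
  have "(LEAST k. k > 0 \<and> odd ((collatz ^^ k) d)) = m"
  proof (rule Least_equality)
    show "m > 0 \<and> odd ((collatz ^^ m) d)"
      using iter [of m] \<open>m > 0\<close> \<open>odd q\<close> by simp
  next
    fix k assume k: "k > 0 \<and> odd ((collatz ^^ k) d)"
    show "m \<le> k"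
    proof (rule ccontr)
      assume "\<not> m \<le> k"
      with iter [of k] k show False by simp
    qed
  qed
  then show ?thesis
    using iter [of m] \<open>m > 0\<close> R by simp
qed

(* The flag is True for 1 and False for 0.
   alg_step flag b_i b_(i-1) = (c_i, new flag) *)
fun alg_step :: "bool \<Rightarrow> bool \<Rightarrow> bool \<Rightarrow> bool \<times> bool" where
  "alg_step False False False = (False, False)"
| "alg_step False False True  = (True, False)"
| "alg_step False True  False = (True, False)"
| "alg_step False True  True  = (False, True)"
| "alg_step True  False False = (True, False)"
| "alg_step True  False True  = (False, True)"
| "alg_step True  True  False = (False, True)"
| "alg_step True  True  True  = (True, True)"

(* Input b_0, b_1, ... and output c_1, c_2, ... are listed from right to left,
   i.e. least significant digit first. *)
fun alg_scan :: "bool \<Rightarrow> bool list \<Rightarrow> bool list" where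
  "alg_scan flag (x # y # bs) =
     (let (c, flag') = alg_step flag y x in c # alg_scan flag' (y # bs))"
| "alg_scan flag [x] = []"
| "alg_scan flag [] = []"

definition strip_zeros :: "bool list \<Rightarrow> bool list" where
  "strip_zeros cs = rev (dropWhile Not (rev (dropWhile Not cs)))"

definition collatz_algorithm :: "bool list \<Rightarrow> bool list" where
  "collatz_algorithm bs =
     strip_zeros (rev (False # alg_scan True (rev ([False, False] @ bs))))"

end

(* Algorithm 1 is schoolbook binary addition d + 2d + 1 with the flag as carry:
   column i adds b_i + b_(i-1) + carry, and column 0 is b_0 + 1 = 2, that is, digit 0
   with carry 1. The two leading zeros absorb the last carry, so the output before
   stripping represents 3d + 1; removing trailing zeros divides out the powers of 2. *)

theory Submission
  imports Defs
begin

lemma alg_step_full_adder: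
  "alg_step f y x = (c, f') \<Longrightarrow> of_bool c + 2 * of_bool f' = (of_bool y + of_bool x + of_bool f :: nat)"
  by (cases f; cases y; cases x) auto

text \<open>Each step adds \<open>x\<close> from \<open>x # xs\<close> to the next digit from
  \<open>xs\<close>, so induction must vary both \<open>x\<close> and the carry \<open>f\<close>.
  Two padding zeros give just enough columns to write out the final carry.\<close>

lemma horner_sum_alg_scan:
  "(horner_sum of_bool 2 (alg_scan f (x # xs @ [False, False])) :: nat)
   = horner_sum of_bool 2 xs + horner_sum of_bool 2 (x # xs) + of_bool f"
proof (induction xs arbitrary: x f)
  case Nil
  then show ?case by (cases f; cases x) simp_all
next
  case (Cons y ys)
  obtain c f' where step: "alg_step f y x = (c, f')" by fastforce
  show ?case
    using alg_step_full_adder [OF step] Cons.IH [of f' y] by (simp add: step)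
qed

lemma binary_rep_0 [simp]: "binary_rep 0 = []"
  by (simp add: binary_rep.simps)

lemma binary_rep_double: "n > 0 \<Longrightarrow> binary_rep (2 * n) = binary_rep n @ [False]"
  by (subst binary_rep.simps) simp

lemma binary_rep_double_plus_1: "binary_rep (Suc (2 * n)) = binary_rep n @ [True]"
  by (subst binary_rep.simps) simp

text \<open>Induction on the lowest digit: it is at risk of being dropped only if all higher digits
  are zero, hence the case split on their value.\<close>

lemma dropWhile_Not_rev_eq_binary_rep:
  "dropWhile Not (rev cs) = binary_rep (horner_sum of_bool 2 cs)"
proof (induction cs)
  case Nil
  then show ?case by simp
next
  case (Cons c cs)
  let ?n = "horner_sum of_bool 2 cs :: nat"
  show ?case
  proof (cases "?n = 0")
    case True
    \<comment> \<open>Value 0 has the empty representation, so by induction every digit was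
      dropped.\<close>
    then have "\<forall>x \<in> set cs. \<not> x"
      using Cons.IH by (auto simp: dropWhile_eq_Nil_conv)
    then show ?thesis
      using True binary_rep_double_plus_1 [of 0] by (cases c) (auto simp: dropWhile_append)
  next
    case False
    then have "\<exists>x \<in> set cs. x"
      using Cons.IH binary_rep_leading [of ?n] dropWhile_eq_Nil_conv [of Not "rev cs"] by auto
    then have "dropWhile Not (rev (c # cs)) = binary_rep ?n @ [c]"
      using Cons.IH by (auto simp: dropWhile_append)
    then show ?thesis
      using False binary_rep_double [of ?n] binary_rep_double_plus_1 [of ?n] by (cases c) simp_all
  qed
qed

text \<open>For positive even \<open>n\<close>, dropping the last 0 halves \<open>n\<close> and
  lowers the multiplicity by one; for odd \<open>n\<close> nothing is dropped.\<close>

lemma rev_dropWhile_Not_rev_binary_rep: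
  "rev (dropWhile Not (rev (binary_rep n))) = binary_rep (n div 2 ^ multiplicity 2 n)"
proof (induction n rule: less_induct)
  case (less n)
  consider "n = 0" | m where "n = 2 * m" "m > 0" | m where "n = Suc (2 * m)"
    by (metis oddE evenE Suc_eq_plus1 mult_0_right neq0_conv)
  then show ?case
  proof cases
    case 2
    then show ?thesis
      using less.IH [of m] by (simp add: binary_rep_double multiplicity_times_same)
  next
    case 3
    then show ?thesis
      by (simp add: binary_rep_double_plus_1 not_dvd_imp_multiplicity_0)
  qed simp
qed

lemma strip_zeros_rev:
  "strip_zeros (rev cs) = binary_rep (n div 2 ^ multiplicity 2 n)"
  if "horner_sum of_bool 2 cs = n"
  unfolding strip_zeros_def dropWhile_Not_rev_eq_binary_rep [of cs] that
  by (rule rev_dropWhile_Not_rev_binary_rep)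

theorem mainTheorem1:
  fixes d :: nat
  assumes "odd d"
  shows "collatz_algorithm (binary_rep d) = binary_rep (reduced_collatz d)"
proof -
  obtain m where m: "d = Suc (2 * m)"
    using assms by (auto elim: oddE)
  define xs where "xs = rev (binary_rep m)"
  have digits: "rev (binary_rep d) = True # xs"
    by (simp add: m binary_rep_double_plus_1 xs_def)
  have "horner_sum of_bool 2 xs = m"
    by (simp add: xs_def binary_rep_value)
  \<comment> \<open>The scanned columns sum to \<open>m + d + 1\<close>; the 0 in column 0 doubles
    this, and \<open>2 * m + 1 = d\<close>.\<close>
  then have "horner_sum of_bool 2 (False # alg_scan True (True # xs @ [False, False])) = 3 * d + 1"
    by (simp only: horner_sum_simps horner_sum_alg_scan) (simp add: m)
  from strip_zeros_rev [OF this] show ?thesis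
    by (simp only: collatz_algorithm_def reduced_collatz_def rev_append digits
        rev.simps append.simps append_assoc)
qed

end
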